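(* There exists an integral feasible solution $(\tilde x,\tilde y)$ of $\textsc{FacilityMatLP}(w',\mathcal M)$ with $\mathrm{cost}_{w'}(\tilde x,\tilde y)\le(4\cdot3^{p-1}+2)\cdot3^p\cdot z^*$, where $z^*$ is the optimal value of $\textsc{FacilityMatLP}(w,\mathcal M)$.
   Context: Setting: $p\ge1$; a finite metric $d$ on $P\cup\mathcal F$; $f:\mathcal F\to\mathbb{R}_{\ge0}$; $w:P\to\mathbb{R}_{\ge0}$; matroid $\mathcal M$ on $\mathcal F$ with rank function $r$. $\mathrm{cost}_\omega(x,y)=\sum_uf(u)y_u+\sum_{v,u}\omega(v)d(v,u)^px_{vu}$; $\textsc{FacilityMatLP}(\omega,\mathcal M)$ minimizes it s.t. $\sum_ux_{vu}\ge1$ ($v\in P$), $\sum_{u\in S}y_u\le r(S)$ ($S\subseteq\mathcal F$), $0\le x_{vu}\le y_u$. Let $(x,y)$ be an optimal solution for $w$ with $\sum_ux_{vu}=1$ and $\mathcal R(v)=(\sum_ud(v,u)^px_{vu})^{1/p}$. The demands $w'$ come from client consolidation: order clients so that $\mathcal R(v_1)\le\dots\le\mathcal R(v_n)$; set $w'=w$; for $i=1,\dots,n-1$ and $j=i+1,\dots,n$: if $d(v_i,v_j)\le2^{(p+1)/p}\mathcal R(v_j)$ and $w'(v_i)>0$, set $w'(v_i)\leftarrow w'(v_i)+w'(v_j)$, $w'(v_j)\leftarrow0$. Assume the support of $w'$ has at least two clients. *)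

theory Defs
  imports Complex_Main
begin

definition finite_metric_on :: "'a set \<Rightarrow> ('a \<Rightarrow> 'a \<Rightarrow> real) \<Rightarrow> bool" where
  "finite_metric_on X d \<longleftrightarrow> finite X \<and>
     (\<forall>a\<in>X. \<forall>b\<in>X. d a b \<ge> 0 \<and> (d a b = 0 \<longleftrightarrow> a = b) \<and> d a b = d b a) \<and>
     (\<forall>a\<in>X. \<forall>b\<in>X. \<forall>c\<in>X. d a c \<le> d a b + d b c)"

definition matroid :: "'a set \<Rightarrow> ('a set \<Rightarrow> bool) \<Rightarrow> bool" where
  "matroid E indep \<longleftrightarrow> finite E \<and>
     (\<forall>I. indep I \<longrightarrow> I \<subseteq> E) \<and>
     indep {} \<and>
     (\<forall>I J. indep J \<and> I \<subseteq> J \<longrightarrow> indep I) \<and>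
     (\<forall>I J. indep I \<and> indep J \<and> card I < card J \<longrightarrow> (\<exists>e\<in>J - I. indep (insert e I)))"

definition mrank :: "('a set \<Rightarrow> bool) \<Rightarrow> 'a set \<Rightarrow> nat" where
  "mrank indep S = Max {card I | I. I \<subseteq> S \<and> indep I}"

definition fml_feasible ::
  "'a set \<Rightarrow> 'a set \<Rightarrow> ('a set \<Rightarrow> bool) \<Rightarrow> ('a \<Rightarrow> 'a \<Rightarrow> real) \<Rightarrow> ('a \<Rightarrow> real) \<Rightarrow> bool" where
  "fml_feasible P F indep x y \<longleftrightarrow>
     (\<forall>v\<in>P. (\<Sum>u\<in>F. x v u) \<ge> 1) \<and>
     (\<forall>S. S \<subseteq> F \<longrightarrow> (\<Sum>u\<in>S. y u) \<le> real (mrank indep S)) \<and>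
     (\<forall>v\<in>P. \<forall>u\<in>F. 0 \<le> x v u \<and> x v u \<le> y u)"

definition fml_integral ::
  "'a set \<Rightarrow> 'a set \<Rightarrow> ('a \<Rightarrow> 'a \<Rightarrow> real) \<Rightarrow> ('a \<Rightarrow> real) \<Rightarrow> bool" where
  "fml_integral P F x y \<longleftrightarrow> (\<forall>v\<in>P. \<forall>u\<in>F. x v u \<in> \<int>) \<and> (\<forall>u\<in>F. y u \<in> \<int>)"

definition fml_cost ::
  "'a set \<Rightarrow> 'a set \<Rightarrow> ('a \<Rightarrow> 'a \<Rightarrow> real) \<Rightarrow> real \<Rightarrow> ('a \<Rightarrow> real) \<Rightarrow> ('a \<Rightarrow> real)
     \<Rightarrow> ('a \<Rightarrow> 'a \<Rightarrow> real) \<Rightarrow> ('a \<Rightarrow> real) \<Rightarrow> real" where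
  "fml_cost P F d p f \<omega> x y =
     (\<Sum>u\<in>F. f u * y u) + (\<Sum>v\<in>P. \<Sum>u\<in>F. \<omega> v * (d v u) powr p * x v u)"

definition fml_optimal ::
  "'a set \<Rightarrow> 'a set \<Rightarrow> ('a \<Rightarrow> 'a \<Rightarrow> real) \<Rightarrow> real \<Rightarrow> ('a \<Rightarrow> real) \<Rightarrow> ('a \<Rightarrow> real)
     \<Rightarrow> ('a set \<Rightarrow> bool) \<Rightarrow> ('a \<Rightarrow> 'a \<Rightarrow> real) \<Rightarrow> ('a \<Rightarrow> real) \<Rightarrow> bool" where
  "fml_optimal P F d p f \<omega> indep x y \<longleftrightarrow> fml_feasible P F indep x y \<and>
     (\<forall>x' y'. fml_feasible P F indep x' y' \<longrightarrow>
        fml_cost P F d p f \<omega> x y \<le> fml_cost P F d p f \<omega> x' y')"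

definition conn_radius :: "'a set \<Rightarrow> ('a \<Rightarrow> 'a \<Rightarrow> real) \<Rightarrow> real \<Rightarrow> ('a \<Rightarrow> 'a \<Rightarrow> real) \<Rightarrow> 'a \<Rightarrow> real" where
  "conn_radius F d p x v = (\<Sum>u\<in>F. (d v u) powr p * x v u) powr (1 / p)"

definition consol_step ::
  "('a \<Rightarrow> 'a \<Rightarrow> real) \<Rightarrow> real \<Rightarrow> ('a \<Rightarrow> real) \<Rightarrow> 'a \<Rightarrow> 'a \<Rightarrow> ('a \<Rightarrow> real) \<Rightarrow> ('a \<Rightarrow> real)" where
  "consol_step d p R vi vj w =
     (if d vi vj \<le> 2 powr ((p + 1) / p) * R vj \<and> w vi > 0
      then w(vi := w vi + w vj, vj := 0) else w)"

text \<open>Outer loop over i; the inner loop runs over j = i+1..n in order.\<close>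
fun consolidate ::
  "('a \<Rightarrow> 'a \<Rightarrow> real) \<Rightarrow> real \<Rightarrow> ('a \<Rightarrow> real) \<Rightarrow> 'a list \<Rightarrow> ('a \<Rightarrow> real) \<Rightarrow> ('a \<Rightarrow> real)" where
  "consolidate d p R [] w = w"
| "consolidate d p R (vi # vs) w = consolidate d p R vs (fold (consol_step d p R vi) vs w)"

end

theory Submission
  imports Defs
begin

text \<open>Let Q be the support of the consolidated demands, and for v in Q let 2\<rho>(v) be the distance from v
  to its nearest other point of Q. The open balls of radius \<rho>(v) are disjoint, and by Markov's inequality
  each carries at least half of the unit fractional assignment of v. Restrict the facility weights
  to these balls, using x on each ball. Nearest-neighbour pairs, chosen greedily by increasing \<rho>
  so as to be disjoint, then carry weight at least 1 each. The matroid constraints, the constraints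
  ``at most 1 per ball'' and ``at least 1 per pair'' describe an integral polytope, so the
  weights can be rounded without increasing a linear cost that charges \<rho>(v)^p to an empty ball. If the
  ball of v stays empty, an open facility within 5\<rho>(v) is reached through the pair that blocked v,
  which gives the factor 5^p \<le> 9^p.\<close>

section \<open>Matroid rank\<close>

lemma mrank_set_finite:
  assumes "matroid F indep" "S \<subseteq> F"
  shows "finite {card I | I. I \<subseteq> S \<and> indep I}"
proof -
  have "finite S" using assms by (auto simp: matroid_def intro: finite_subset)
  then have "finite (card ` Pow S)" by simp
  then show ?thesis by (rule rev_finite_subset) auto
qed

lemma card_le_mrank:
  assumes "matroid F indep" "S \<subseteq> F" "I \<subseteq> S" "indep I"
  shows "card I \<le> mrank indep S"
  unfolding mrank_def using assms mrank_set_finite[OF assms(1,2)] by (intro Max_ge) auto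

lemma mrank_attained:
  assumes "matroid F indep" "S \<subseteq> F"
  shows "\<exists>I. I \<subseteq> S \<and> indep I \<and> card I = mrank indep S"
proof -
  have "{card I | I. I \<subseteq> S \<and> indep I} \<noteq> {}" using assms by (auto simp: matroid_def)
  from Max_in[OF mrank_set_finite[OF assms] this] show ?thesis unfolding mrank_def by auto
qed

lemma mrank_empty: "matroid F indep \<Longrightarrow> mrank indep {} = 0"
  using mrank_attained[of F indep "{}"] by auto

text \<open>A largest independent set between \<open>I\<close> and \<open>S\<close> works: were it
  smaller than the rank, augmentation from an independent set attaining the rank would enlarge it
  inside \<open>S\<close>.\<close>

lemma extend_to_basis:
  assumes M: "matroid F indep" and S: "S \<subseteq> F" and I: "indep I" "I \<subseteq> S"
  shows "\<exists>J. I \<subseteq> J \<and> J \<subseteq> S \<and> indep J \<and> card J = mrank indep S"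
proof -
  have fS: "finite S" using M S by (auto simp: matroid_def intro: finite_subset)
  define \<J> where "\<J> = {J. I \<subseteq> J \<and> J \<subseteq> S \<and> indep J}"
  have fin: "finite \<J>" by (rule finite_subset[of _ "Pow S"]) (auto simp: \<J>_def fS)
  have ne: "\<J> \<noteq> {}" using I by (auto simp: \<J>_def)
  define m where "m = Max (card ` \<J>)"
  have "m \<in> card ` \<J>" unfolding m_def using fin ne by (intro Max_in) auto
  then obtain J where J: "J \<in> \<J>" "card J = m" by auto
  have "\<not> card J < mrank indep S"
  proof
    assume lt: "card J < mrank indep S"
    obtain K where K: "K \<subseteq> S" "indep K" "card K = mrank indep S"
      using mrank_attained[OF M S] by blast
    have "indep J" using J by (auto simp: \<J>_def)
    with M K lt obtain e where e: "e \<in> K - J" "indep (insert e J)"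
      unfolding matroid_def by metis
    have "insert e J \<in> \<J>" using e K J by (auto simp: \<J>_def)
    then have "card (insert e J) \<le> m" unfolding m_def using fin by (intro Max_ge) auto
    moreover have "finite J" using J fS by (auto simp: \<J>_def intro: finite_subset)
    ultimately show False using e J by auto
  qed
  then have "card J = mrank indep S"
    using card_le_mrank[OF M S, of J] J by (auto simp: \<J>_def)
  then show ?thesis using J by (auto simp: \<J>_def)
qed

text \<open>Extend a basis \<open>I\<close> of \<open>S \<inter> T\<close> to a basis
  \<open>J\<close> of \<open>S \<union> T\<close>. The traces of \<open>J\<close> on
  \<open>S\<close> and on \<open>T\<close> are independent, and their sizes add up to at least
  \<open>card J + card I\<close> because \<open>I\<close> lies in both.\<close>

lemma mrank_submodular:
  assumes M: "matroid F indep" and S: "S \<subseteq> F" and T: "T \<subseteq> F"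
  shows "mrank indep (S \<union> T) + mrank indep (S \<inter> T) \<le> mrank indep S + mrank indep T"
proof -
  obtain I where I: "I \<subseteq> S \<inter> T" "indep I" "card I = mrank indep (S \<inter> T)"
    using mrank_attained[OF M, of "S \<inter> T"] S by blast
  obtain J where J: "I \<subseteq> J" "J \<subseteq> S \<union> T" "indep J" "card J = mrank indep (S \<union> T)"
    using extend_to_basis[OF M, of "S \<union> T" I] I S T by blast
  have fJ: "finite J" using M J S T by (metis matroid_def finite_subset)
  have sub: "\<And>X. X \<subseteq> J \<Longrightarrow> indep X" using M J(3) unfolding matroid_def by blast
  have "card J + card I \<le> card ((J \<inter> S) \<union> (J \<inter> T)) + card ((J \<inter> S) \<inter> (J \<inter> T))"
    using I J fJ by (intro add_mono card_mono) auto
  also have "\<dots> = card (J \<inter> S) + card (J \<inter> T)"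
    using fJ by (intro card_Un_Int[symmetric]) auto
  also have "\<dots> \<le> mrank indep S + mrank indep T"
    using card_le_mrank[OF M S, of "J \<inter> S"] card_le_mrank[OF M T, of "J \<inter> T"] sub
    by (intro add_mono) auto
  finally show ?thesis using I J by simp
qed

section \<open>Vertices of polyhedra\<close>

text \<open>Gaussian elimination by induction on the equations: a trivial equation is dropped, any
  other one is used to eliminate an unknown.\<close>

lemma underdetermined_system_nontrivial:
  fixes a :: "'k \<Rightarrow> 'a \<Rightarrow> 'f::field"
  assumes "finite K" "finite E" "card K < card E"
  shows "\<exists>z. (\<exists>u\<in>E. z u \<noteq> 0) \<and> (\<forall>k\<in>K. (\<Sum>u\<in>E. a k u * z u) = 0)"
  using assms
proof (induction K arbitrary: E a rule: finite_induct)
  case empty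
  then have "E \<noteq> {}" by auto
  then show ?case by (intro exI[of _ "\<lambda>_. 1"]) auto
next
  case (insert k K)
  show ?case
  proof (cases "\<forall>u\<in>E. a k u = 0")
    case True
    have "card K < card E" using insert by simp
    from insert.IH[OF insert.prems(1) this, of a] True show ?thesis by auto
  next
    case False
    then obtain u0 where u0: "u0 \<in> E" "a k u0 \<noteq> 0" by blast
    define E' where "E' = E - {u0}"
    have E: "E = insert u0 E'" "u0 \<notin> E'" "finite E'" using u0 insert.prems by (auto simp: E'_def)
    have "card K < card E'" using insert E by simp
    \<comment> \<open>The system after elimination of \<open>u0\<close>: from each equation
      \<open>j\<close>, subtract the multiple of equation \<open>k\<close> that cancels its entry at
      \<open>u0\<close>.\<close>
    from insert.IH[OF E(3) this, of "\<lambda>j u. a j u - a j u0 / a k u0 * a k u"]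
    obtain z where z: "\<exists>u\<in>E'. z u \<noteq> 0"
      "\<forall>j\<in>K. (\<Sum>u\<in>E'. (a j u - a j u0 / a k u0 * a k u) * z u) = 0" by blast
    define s where "s = (\<Sum>u\<in>E'. a k u * z u)"
    \<comment> \<open>Back substitution: the value at \<open>u0\<close> that solves equation
      \<open>k\<close>.\<close>
    define z' where "z' = z(u0 := - s / a k u0)"
    have sum': "(\<Sum>u\<in>E. a j u * z' u) = (\<Sum>u\<in>E'. a j u * z u) - a j u0 * s / a k u0" for j
    proof -
      have "(\<Sum>u\<in>E'. a j u * z' u) = (\<Sum>u\<in>E'. a j u * z u)"
        using E by (intro sum.cong) (auto simp: z'_def)
      then show ?thesis using E by (simp add: z'_def)
    qed
    have "(\<Sum>u\<in>E. a j u * z' u) = 0" if "j \<in> K" for j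
    proof -
      have "0 = (\<Sum>u\<in>E'. (a j u - a j u0 / a k u0 * a k u) * z u)" using z that by simp
      also have "\<dots> = (\<Sum>u\<in>E'. a j u * z u) - a j u0 / a k u0 * s"
        unfolding s_def by (simp add: left_diff_distrib sum_subtractf sum_distrib_left mult.assoc)
      finally show ?thesis by (simp add: sum')
    qed
    moreover have "(\<Sum>u\<in>E. a k u * z' u) = 0" using u0 by (simp add: sum' s_def[symmetric])
    moreover have "\<exists>u\<in>E. z' u \<noteq> 0" using z E by (auto simp: z'_def)
    ultimately show ?thesis by (intro exI[of _ z']) auto
  qed
qed

definition satisfies :: "'a set \<Rightarrow> (('a \<Rightarrow> real) \<times> real) set \<Rightarrow> ('a \<Rightarrow> real) \<Rightarrow> bool" where
  "satisfies E C y \<longleftrightarrow> (\<forall>(a, b) \<in> C. (\<Sum>u\<in>E. a u * y u) \<le> b)"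

text \<open>While some nonzero direction keeps all tight constraints tight, move along it, with the
  sign that does not raise the cost, until a further constraint becomes tight. The number of slack
  constraints drops each time. By \<open>bdd\<close> every nonzero direction is blocked at some
  point; the last conjunct says that \<open>y'\<close> is a vertex.\<close>

lemma exists_vertex_no_worse:
  fixes C :: "(('a \<Rightarrow> real) \<times> real) set" and c y :: "'a \<Rightarrow> real"
  assumes fC: "finite C"
    and bdd: "\<And>z. \<exists>u\<in>E. z u \<noteq> 0 \<Longrightarrow> \<exists>(a, b)\<in>C. (\<Sum>u\<in>E. a u * z u) > 0"
    and y: "satisfies E C y"
  shows "\<exists>y'. satisfies E C y' \<and> (\<Sum>u\<in>E. c u * y' u) \<le> (\<Sum>u\<in>E. c u * y u) \<and>
    (\<forall>z. (\<forall>(a, b)\<in>C. (\<Sum>u\<in>E. a u * y' u) = b \<longrightarrow> (\<Sum>u\<in>E. a u * z u) = 0) \<longrightarrow> (\<forall>u\<in>E. z u = 0))"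
  using y
proof (induction "card {(a, b)\<in>C. (\<Sum>u\<in>E. a u * y u) \<noteq> b}" arbitrary: y rule: less_induct)
  case less
  define dot where "dot = (\<lambda>a z :: 'a \<Rightarrow> real. \<Sum>u\<in>E. a u * z u)"
  show ?case
  proof (cases "\<forall>z. (\<forall>(a, b)\<in>C. dot a y = b \<longrightarrow> dot a z = 0) \<longrightarrow> (\<forall>u\<in>E. z u = 0)")
    case True
    then show ?thesis using less.prems unfolding dot_def by (intro exI[of _ y]) auto
  next
    case False
    then obtain z0 where z0: "\<forall>(a, b)\<in>C. dot a y = b \<longrightarrow> dot a z0 = 0" "\<exists>u\<in>E. z0 u \<noteq> 0" by blast
    define z where "z = (if dot c z0 \<le> 0 then z0 else (\<lambda>u. - z0 u))"
    have dneg: "dot a (\<lambda>u. - z0 u) = - dot a z0" for a by (simp add: dot_def sum_negf)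
    have z: "\<forall>(a, b)\<in>C. dot a y = b \<longrightarrow> dot a z = 0" "\<exists>u\<in>E. z u \<noteq> 0" "dot c z \<le> 0"
      using z0 by (auto simp: z_def dneg)
    define K where "K = {(a, b)\<in>C. dot a z > 0}"
    have K: "finite K" "K \<noteq> {}"
      using bdd[OF z(2)] finite_subset[OF _ fC, of K] by (auto simp: K_def dot_def)
    \<comment> \<open>Ratio test: \<open>g\<close> is the step length at which a constraint of
      \<open>K\<close> becomes tight, so the minimum \<open>\<epsilon>\<close> is the longest
      feasible step.\<close>
    define g where "g = (\<lambda>(a, b). (b - dot a y) / dot a z)"
    define \<epsilon> where "\<epsilon> = Min (g ` K)"
    have feas: "dot a y \<le> b" if "(a, b) \<in> C" for a b
      using less.prems that by (auto simp: satisfies_def dot_def)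
    have "\<epsilon> \<in> g ` K" unfolding \<epsilon>_def using K by (intro Min_in) auto
    then obtain a0 b0 where k0: "(a0, b0) \<in> K" "\<epsilon> = g (a0, b0)" by auto
    have \<epsilon>le: "\<epsilon> \<le> g k" if "k \<in> K" for k unfolding \<epsilon>_def using K that by (intro Min_le) auto
    have \<epsilon>0: "\<epsilon> \<ge> 0" using k0 feas[of a0 b0] by (auto simp: g_def K_def)
    define y' where "y' = (\<lambda>u. y u + \<epsilon> * z u)"
    have dy': "dot a y' = dot a y + \<epsilon> * dot a z" for a
      by (simp add: dot_def y'_def algebra_simps sum.distrib sum_distrib_left)
    have "dot a y' \<le> b" if ab: "(a, b) \<in> C" for a b
    proof (cases "dot a z > 0")
      case True
      then have "(a, b) \<in> K" using ab by (auto simp: K_def)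
      from \<epsilon>le[OF this] True show ?thesis by (simp add: dy' g_def field_simps)
    next
      case False
      then have "\<epsilon> * dot a z \<le> 0" using \<epsilon>0 by (simp add: mult_nonneg_nonpos)
      then show ?thesis using feas[OF ab] by (simp add: dy')
    qed
    then have satisfies': "satisfies E C y'" by (auto simp: satisfies_def dot_def)
    have k0C: "(a0, b0) \<in> C" "dot a0 z > 0" using k0 by (auto simp: K_def)
    then have "dot a0 y' = b0" using k0 by (simp add: dy' g_def)
    \<comment> \<open>Tight constraints are orthogonal to \<open>z\<close>, but
      \<open>dot a0 z > 0\<close>, so the constraint just reached was slack before.\<close>
    moreover have "dot a0 y \<noteq> b0" using z(1) k0C by auto
    moreover have "dot a y' = b" if "(a, b) \<in> C" "dot a y = b" for a b
      using z(1) that by (auto simp: dy')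
    ultimately have "{(a, b)\<in>C. dot a y' \<noteq> b} \<subseteq> {(a, b)\<in>C. dot a y \<noteq> b}"
      "(a0, b0) \<in> {(a, b)\<in>C. dot a y \<noteq> b}" "(a0, b0) \<notin> {(a, b)\<in>C. dot a y' \<noteq> b}"
      using k0C by auto
    moreover have "finite {(a, b)\<in>C. dot a y \<noteq> b}" by (rule finite_subset[OF _ fC]) auto
    ultimately have "card {(a, b)\<in>C. dot a y' \<noteq> b} < card {(a, b)\<in>C. dot a y \<noteq> b}"
      by (intro psubset_card_mono) blast+
    from less.hyps[OF this[unfolded dot_def] satisfies'] obtain y'' where
      y'': "satisfies E C y''" "dot c y'' \<le> dot c y'"
      "\<forall>z. (\<forall>(a, b)\<in>C. dot a y'' = b \<longrightarrow> dot a z = 0) \<longrightarrow> (\<forall>u\<in>E. z u = 0)"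
      unfolding dot_def by blast
    have "dot c y' \<le> dot c y" using z(3) \<epsilon>0 by (simp add: dy' mult_nonneg_nonpos)
    with y'' show ?thesis unfolding dot_def by (intro exI[of _ y'']) auto
  qed
qed

text \<open>Each family has at most \<open>card E / 2\<close> members. With fewer than
  \<open>card E\<close> sets altogether, a dimension count suffices. Otherwise both families
  partition \<open>E\<close>, so the equations of \<open>L\<close> and those of \<open>R\<close>
  have the same total and one of them is redundant.\<close>

lemma two_disjoint_families_nontrivial:
  assumes fE: "finite E" "E \<noteq> {}"
    and L: "\<And>A. A \<in> L \<Longrightarrow> card (A \<inter> E) \<ge> 2" "pairwise disjnt L" "finite L"
    and R: "\<And>A. A \<in> R \<Longrightarrow> card (A \<inter> E) \<ge> 2" "pairwise disjnt R" "finite R"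
  shows "\<exists>z :: 'a \<Rightarrow> real. (\<exists>u\<in>E. z u \<noteq> 0) \<and> (\<forall>A\<in>L \<union> R. sum z (A \<inter> E) = 0)"
proof -
  have union: "card (\<Union>A\<in>L. A \<inter> E) = (\<Sum>A\<in>L. card (A \<inter> E))"
    if "pairwise disjnt L" "finite L" for L :: "'a set set"
    using that fE by (intro card_UN_disjoint) (auto simp: pairwise_def disjnt_def)
  have count: "2 * card L \<le> card (\<Union>A\<in>L. A \<inter> E)"
    if "\<And>A. A \<in> L \<Longrightarrow> card (A \<inter> E) \<ge> 2" "pairwise disjnt L" "finite L" for L :: "'a set set"
    using sum_mono[of L "\<lambda>_. 2" "\<lambda>A. card (A \<inter> E)"] that union[of L] by simp
  have le: "card (\<Union>A\<in>L. A \<inter> E) \<le> card E" for L :: "'a set set"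
    using fE by (intro card_mono) auto
  \<comment> \<open>A family with \<open>card E / 2\<close> members, each taking at least two
    elements, leaves no element of \<open>E\<close> uncovered.\<close>
  have sumE: "sum z E = (\<Sum>A\<in>L. sum z (A \<inter> E))"
    if "2 * card L = card E" "\<And>A. A \<in> L \<Longrightarrow> card (A \<inter> E) \<ge> 2" "pairwise disjnt L" "finite L"
    for L :: "'a set set" and z :: "'a \<Rightarrow> real"
  proof -
    have "(\<Union>A\<in>L. A \<inter> E) = E"
      using count[of L] le[of L] that fE by (intro card_subset_eq) auto
    then have "sum z E = sum z (\<Union>A\<in>L. A \<inter> E)" by simp
    also have "\<dots> = (\<Sum>A\<in>L. sum z (A \<inter> E))"
      using that fE by (intro sum.UNION_disjoint) (auto simp: pairwise_def disjnt_def)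
    finally show ?thesis .
  qed
  have solve: "\<exists>z :: 'a \<Rightarrow> real. (\<exists>u\<in>E. z u \<noteq> 0) \<and> (\<forall>A\<in>K. sum z (A \<inter> E) = 0)"
    if "finite K" "card K < card E" for K
  proof -
    have "(\<Sum>u\<in>E. (if u \<in> A then 1 else 0) * z u) = sum z (A \<inter> E)" for A and z :: "'a \<Rightarrow> real"
    proof -
      have "(\<Sum>u\<in>E. (if u \<in> A then 1 else 0) * z u) = (\<Sum>u\<in>E. if u \<in> A then z u else 0)"
        by (rule sum.cong) simp_all
      then show ?thesis using sum.inter_restrict[OF fE(1), of z A] by (simp add: Int_commute)
    qed
    then show ?thesis
      using underdetermined_system_nontrivial[OF that(1) fE(1) that(2),
          of "\<lambda>A u. if u \<in> A then 1 else (0::real)"] by simp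
  qed
  show ?thesis
  proof (cases "card (L \<union> R) < card E")
    case True
    then show ?thesis using solve[of "L \<union> R"] L R by simp
  next
    case False
    have cLR: "card (L \<union> R) \<le> card L + card R" by (rule card_Un_le)
    have eq: "2 * card L = card E" "2 * card R = card E"
      using False cLR count[OF L] count[OF R] le[of L] le[of R] by linarith+
    have "card L > 0" using eq fE by (metis card_gt_0_iff mult_0_right neq0_conv)
    then obtain A0 where A0: "A0 \<in> L" by fastforce
    define K where "K = (L - {A0}) \<union> R"
    have "card K \<le> card (L - {A0}) + card R" unfolding K_def by (rule card_Un_le)
    also have "\<dots> < card E" using A0 eq L(3) \<open>card L > 0\<close> by (simp add: card_Diff_singleton)
    finally have "card K < card E" .
    then obtain z :: "'a \<Rightarrow> real" where z: "\<exists>u\<in>E. z u \<noteq> 0" "\<forall>A\<in>K. sum z (A \<inter> E) = 0"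
      using solve[of K] L R by (auto simp: K_def)
    \<comment> \<open>The total over \<open>E\<close> is computed through either partition; every
      term except that of \<open>A0\<close> is already known to vanish.\<close>
    have "sum z (A0 \<inter> E) + (\<Sum>A\<in>L-{A0}. sum z (A \<inter> E)) = (\<Sum>A\<in>R. sum z (A \<inter> E))"
      using sumE[OF eq(1) L, of z] sumE[OF eq(2) R, of z] sum.remove[OF L(3) A0, of "\<lambda>A. sum z (A \<inter> E)"]
      by simp
    then have "sum z (A0 \<inter> E) = 0" using z(2) by (simp add: K_def)
    then show ?thesis using z by (intro exI[of _ z]) (auto simp: K_def)
  qed
qed

section \<open>Integrality of the rounding polytope\<close>

text \<open>A single fractional element would equal the integral total minus an integral
  rest.\<close>

lemma integer_sum_two_fractional:
  fixes y :: "'a \<Rightarrow> real"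
  assumes "finite D" "sum y D \<in> \<int>" "D \<inter> {u. y u \<notin> \<int>} \<noteq> {}"
  shows "card (D \<inter> {u. y u \<notin> \<int>}) \<ge> 2"
proof (rule ccontr)
  let ?E = "D \<inter> {u. y u \<notin> \<int>}"
  assume "\<not> card ?E \<ge> 2"
  moreover have "card ?E > 0" using assms by (simp add: card_gt_0_iff)
  ultimately have "card ?E = 1" by linarith
  then obtain e where e: "?E = {e}" by (auto simp: card_1_singleton_iff)
  have "sum y D = y e + sum y (D - {e})" using assms(1) e by (intro sum.remove) auto
  moreover have "sum y (D - {e}) \<in> \<int>" using e by (intro Ints_sum) auto
  ultimately have "y e = sum y D - sum y (D - {e})" by simp
  then have "y e \<in> \<int>" using assms(2) \<open>sum y (D - {e}) \<in> \<int>\<close> by (simp add: Ints_diff)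
  then show False using e by blast
qed

section \<open>Tight sets of a submodular bound and their atoms\<close>

locale submodular_point =
  fixes F :: "'a set" and r :: "'a set \<Rightarrow> nat" and y :: "'a \<Rightarrow> real"
  assumes fin: "finite F" and r_empty: "r {} = 0"
    and submod: "\<And>S T. S \<subseteq> F \<Longrightarrow> T \<subseteq> F \<Longrightarrow> r (S \<union> T) + r (S \<inter> T) \<le> r S + r T"
    and bound: "\<And>S. S \<subseteq> F \<Longrightarrow> sum y S \<le> real (r S)"
begin

definition "tight S \<longleftrightarrow> S \<subseteq> F \<and> sum y S = real (r S)"

text \<open>The class of \<open>u\<close> when elements that no tight set separates are identified.
  These disjoint classes take the place of the chain of tight sets in the usual uncrossing
  argument.\<close>

definition "atom u = {v\<in>F. \<forall>S. tight S \<longrightarrow> (u \<in> S \<longleftrightarrow> v \<in> S)}"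

text \<open>Uncrossing: \<open>sum y\<close> is modular and \<open>r\<close> submodular, so the
  slacks of union and intersection add up to at most 0; both are nonnegative, hence both
  vanish.\<close>

lemma tight_Un_Int:
  assumes "tight S" "tight T"
  shows "tight (S \<union> T)" "tight (S \<inter> T)"
proof -
  have ST: "S \<subseteq> F" "T \<subseteq> F" "finite S" "finite T"
    using assms fin by (auto simp: tight_def intro: finite_subset)
  have "sum y (S \<union> T) + sum y (S \<inter> T) = sum y S + sum y T" using ST by (intro sum.union_inter)
  also have "\<dots> = real (r S + r T)" using assms by (simp add: tight_def)
  also have "\<dots> \<ge> real (r (S \<union> T) + r (S \<inter> T))" using submod[OF ST(1,2)] by linarith
  finally have *: "real (r (S \<union> T)) + real (r (S \<inter> T)) \<le> sum y (S \<union> T) + sum y (S \<inter> T)" by simp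
  have **: "sum y (S \<union> T) \<le> real (r (S \<union> T))" "sum y (S \<inter> T) \<le> real (r (S \<inter> T))"
    using ST by (auto intro!: bound)
  show "tight (S \<union> T)" "tight (S \<inter> T)" using * ** ST by (auto simp: tight_def)
qed

lemma tight_empty: "tight {}" by (simp add: tight_def r_empty)

lemma tight_Union: "finite \<S> \<Longrightarrow> (\<And>S. S \<in> \<S> \<Longrightarrow> tight S) \<Longrightarrow> tight (\<Union>\<S>)"
  by (induction rule: finite_induct) (auto intro: tight_empty tight_Un_Int)

lemma tight_Inter: "finite \<S> \<Longrightarrow> \<S> \<noteq> {} \<Longrightarrow> (\<And>S. S \<in> \<S> \<Longrightarrow> tight S) \<Longrightarrow> tight (\<Inter>\<S>)"
  by (induction rule: finite_ne_induct) (auto intro: tight_Un_Int)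

lemma finite_tight: "finite {S. tight S}"
  by (rule finite_subset[of _ "Pow F"]) (auto simp: tight_def fin)

text \<open>Let \<open>T\<close> be the smallest tight set containing \<open>u\<close>, and
  \<open>W\<close> the union of the tight subsets of \<open>T\<close> that avoid \<open>u\<close>.
  The atom is \<open>T - W\<close>, and both sets are tight, so their weights are ranks and
  therefore integers. \<open>S0\<close> makes the intersection defining \<open>T\<close> range over
  a nonempty family.\<close>

lemma sum_atom_Ints:
  assumes "tight S0" "u \<in> S0"
  shows "sum y (atom u) \<in> \<int>"
proof -
  define T where "T = \<Inter>{S. tight S \<and> u \<in> S}"
  define W where "W = \<Union>{S. tight S \<and> S \<subseteq> T \<and> u \<notin> S}"
  have T: "tight T" unfolding T_def using assms
    by (intro tight_Inter) (auto intro: finite_subset[OF _ finite_tight])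
  have W: "tight W" unfolding W_def
    by (intro tight_Union) (auto intro: finite_subset[OF _ finite_tight])
  have WT: "W \<subseteq> T" by (auto simp: W_def)
  have "atom u = T - W"
  proof (intro equalityI subsetI)
    fix v assume v: "v \<in> atom u"
    then show "v \<in> T - W" by (auto simp: atom_def T_def W_def)
  next
    fix v assume v: "v \<in> T - W"
    then have "v \<in> F" using T by (auto simp: tight_def)
    moreover have "u \<in> S \<longleftrightarrow> v \<in> S" if S: "tight S" for S
    proof
      assume "u \<in> S" then show "v \<in> S" using v S by (auto simp: T_def)
    next
      assume vS: "v \<in> S"
      show "u \<in> S"
      proof (rule ccontr)
        assume "u \<notin> S"
        then have "S \<inter> T \<subseteq> W" using tight_Un_Int(2)[OF S T] by (auto simp: W_def)
        then show False using v vS by auto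
      qed
    qed
    ultimately show "v \<in> atom u" by (auto simp: atom_def)
  qed
  moreover have "sum y (T - W) = sum y T - sum y W"
    using T fin WT by (intro sum_diff) (auto simp: tight_def intro: finite_subset)
  ultimately show ?thesis using T W by (simp add: tight_def)
qed

lemma atom_eq: "v \<in> atom u \<Longrightarrow> atom v = atom u"
  by (auto simp: atom_def)

lemma atom_self: "u \<in> F \<Longrightarrow> u \<in> atom u"
  by (simp add: atom_def)

lemma atom_subset: "tight S \<Longrightarrow> u \<in> S \<Longrightarrow> atom u \<subseteq> S"
  by (auto simp: atom_def)

text \<open>A tight set is the disjoint union of the atoms of its elements, so a direction that
  preserves the weight of these atoms preserves the tight constraint.\<close>

lemma sum_tight_eq_0:
  fixes z :: "'a \<Rightarrow> real"
  assumes S: "tight S" and z: "\<And>u. u \<in> S \<Longrightarrow> sum z (atom u) = 0"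
  shows "sum z S = 0"
proof -
  have SF: "S \<subseteq> F" "finite S" using S fin by (auto simp: tight_def intro: finite_subset)
  have "sum z S = (\<Sum>D\<in>atom ` S. sum z {u\<in>S. atom u = D})"
    using SF by (intro sum.image_gen)
  also have "\<dots> = 0"
  proof (rule sum.neutral, rule ballI)
    fix D assume "D \<in> atom ` S"
    then obtain u where u: "u \<in> S" "D = atom u" by blast
    have "{v\<in>S. atom v = D} = atom u"
      using u atom_eq atom_self atom_subset[OF S] SF by blast
    then show "sum z {u\<in>S. atom u = D} = 0" using z u by simp
  qed
  finally show ?thesis .
qed

end

text \<open>At a vertex of the polytope below, the tight matroid constraints and the tight laminar
  constraints each reduce to disjoint sets of integral weight, so each such set meets the fractional
  elements at least twice. Counting leaves a nonzero direction that preserves all tight constraints.\<close>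

theorem submodular_laminar_rounding:
  fixes F :: "'a set" and r :: "'a set \<Rightarrow> nat" and y c :: "'a \<Rightarrow> real"
  assumes fin: "finite F" and r_empty: "r {} = 0"
    and submod: "\<And>S T. S \<subseteq> F \<Longrightarrow> T \<subseteq> F \<Longrightarrow> r (S \<union> T) + r (S \<inter> T) \<le> r S + r T"
    and \<A>: "\<And>A. A \<in> \<A> \<Longrightarrow> A \<subseteq> F" "pairwise disjnt \<A>"
    and \<B>: "\<And>B. B \<in> \<B> \<Longrightarrow> B \<subseteq> F" "pairwise disjnt \<B>"
    and laminar: "\<And>A B. A \<in> \<A> \<Longrightarrow> B \<in> \<B> \<Longrightarrow> A \<subseteq> B \<or> A \<inter> B = {}"
    and y_nonneg: "\<And>u. u \<in> F \<Longrightarrow> y u \<ge> 0"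
    and y_bound: "\<And>S. S \<subseteq> F \<Longrightarrow> sum y S \<le> real (r S)"
    and y_\<A>: "\<And>A. A \<in> \<A> \<Longrightarrow> sum y A \<le> 1"
    and y_\<B>: "\<And>B. B \<in> \<B> \<Longrightarrow> sum y B \<ge> 1"
  shows "\<exists>y' :: 'a \<Rightarrow> real. (\<forall>u\<in>F. y' u \<ge> 0 \<and> y' u \<in> \<int>) \<and>
    (\<forall>S. S \<subseteq> F \<longrightarrow> sum y' S \<le> real (r S)) \<and> (\<forall>A\<in>\<A>. sum y' A \<le> 1) \<and> (\<forall>B\<in>\<B>. sum y' B \<ge> 1) \<and>
    (\<Sum>u\<in>F. c u * y' u) \<le> (\<Sum>u\<in>F. c u * y u)"
proof -
  define ind where "ind = (\<lambda>(S :: 'a set) u. if u \<in> S then 1 else (0::real))"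
  define C where "C = (\<lambda>S. (ind S, real (r S))) ` Pow F \<union> (\<lambda>u. (\<lambda>v. - ind {u} v, 0)) ` F \<union>
    (\<lambda>A. (ind A, 1)) ` \<A> \<union> (\<lambda>B. (\<lambda>v. - ind B v, -1)) ` \<B>"
  have ind: "(\<Sum>u\<in>F. ind S u * z u) = sum z S" if "S \<subseteq> F" for S z
  proof -
    have "(\<Sum>u\<in>F. ind S u * z u) = (\<Sum>u\<in>F. if u \<in> S then z u else 0)"
      by (rule sum.cong) (simp_all add: ind_def)
    then show ?thesis using sum.inter_restrict[OF fin, of z S] that by (simp add: Int_absorb1)
  qed
  have nind: "(\<Sum>u\<in>F. - ind S u * z u) = - sum z S" if "S \<subseteq> F" for S z
    using ind[OF that, of z] by (simp add: sum_negf)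
  have nsing: "(\<Sum>v\<in>F. - ind {u} v * z v) = - z u" if "u \<in> F" for u z
    using nind[of "{u}" z] that by simp
  have fin\<A>: "finite \<A>" and fin\<B>: "finite \<B>"
    using \<A>(1) \<B>(1) fin by (auto intro!: finite_subset[of _ "Pow F"])
  have finC: "finite C" using fin fin\<A> fin\<B> by (simp add: C_def)
  have sat_iff: "satisfies F C z \<longleftrightarrow> (\<forall>S. S \<subseteq> F \<longrightarrow> sum z S \<le> real (r S)) \<and> (\<forall>u\<in>F. z u \<ge> 0) \<and>
      (\<forall>A\<in>\<A>. sum z A \<le> 1) \<and> (\<forall>B\<in>\<B>. sum z B \<ge> 1)" for z
    using \<A>(1) \<B>(1) unfolding satisfies_def C_def
    by (simp add: ball_Un ind nind nsing del: mult_minus_left) blast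
  have saty: "satisfies F C y" using sat_iff y_nonneg y_bound y_\<A> y_\<B> by blast
  \<comment> \<open>A positive coordinate is blocked by the rank of \<open>{u}\<close>, a negative
    one by nonnegativity.\<close>
  have bdd: "\<exists>(a, b)\<in>C. (\<Sum>u\<in>F. a u * z u) > 0" if nz: "\<exists>u\<in>F. z u \<noteq> 0" for z
  proof -
    obtain u where u: "u \<in> F" "z u \<noteq> 0" using nz by blast
    show ?thesis
    proof (cases "z u > 0")
      case True
      have "(ind {u}, real (r {u})) \<in> C" using u by (auto simp: C_def)
      moreover have "(\<Sum>v\<in>F. ind {u} v * z v) > 0" using ind[of "{u}" z] u True by simp
      ultimately show ?thesis by blast
    next
      case False
      have "(\<lambda>v. - ind {u} v, 0) \<in> C" using u by (auto simp: C_def)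
      moreover have "(\<Sum>v\<in>F. - ind {u} v * z v) > 0" using nsing[of u z] u False by simp
      ultimately show ?thesis by (intro bexI[of _ "(\<lambda>v. - ind {u} v, 0)"]) auto
    qed
  qed
  obtain y' where y': "satisfies F C y'" "(\<Sum>u\<in>F. c u * y' u) \<le> (\<Sum>u\<in>F. c u * y u)"
    and vertex: "\<And>z. (\<And>a b. (a, b) \<in> C \<Longrightarrow> (\<Sum>u\<in>F. a u * y' u) = b \<Longrightarrow> (\<Sum>u\<in>F. a u * z u) = 0) \<Longrightarrow>
      \<forall>u\<in>F. z u = 0"
    using exists_vertex_no_worse[OF finC bdd saty, of c] by blast
  have feas: "\<And>S. S \<subseteq> F \<Longrightarrow> sum y' S \<le> real (r S)" "\<And>u. u \<in> F \<Longrightarrow> y' u \<ge> 0"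
    using y'(1) sat_iff by blast+
  interpret submodular_point F r y'
    using fin r_empty submod feas by unfold_locales
  define E where "E = {u\<in>F. y' u \<notin> \<int>}"
  have "E = {}"
  proof (rule ccontr)
    assume E: "E \<noteq> {}"
    have finE: "finite E" using fin by (simp add: E_def)
    have two: "card (D \<inter> E) \<ge> 2" if "D \<subseteq> F" "sum y' D \<in> \<int>" "D \<inter> E \<noteq> {}" for D
    proof -
      have "D \<inter> E = D \<inter> {u. y' u \<notin> \<int>}" using that by (auto simp: E_def)
      then show ?thesis using integer_sum_two_fractional[of D y'] that fin
        by (auto intro: finite_subset)
    qed
    define L where "L = {atom u | u. u \<in> E \<and> (\<exists>S. tight S \<and> u \<in> S)}"
    \<comment> \<open>A tight \<open>B\<close> that contains a tight \<open>A\<close> is left out,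
      which makes \<open>R\<close> a disjoint family. Its constraint is recovered in
      \<open>z_\<B>\<close>.\<close>
    define R where "R = {A\<in>\<A>. sum y' A = 1 \<and> A \<inter> E \<noteq> {}} \<union>
      {B\<in>\<B>. sum y' B = 1 \<and> B \<inter> E \<noteq> {} \<and> (\<forall>A\<in>\<A>. A \<subseteq> B \<longrightarrow> sum y' A \<noteq> 1)}"
    have L: "card (D \<inter> E) \<ge> 2" if D: "D \<in> L" for D
    proof -
      obtain u S where u: "D = atom u" "u \<in> E" "tight S" "u \<in> S" using D by (auto simp: L_def)
      have "D \<subseteq> F" using u by (auto simp: atom_def)
      moreover have "u \<in> D" using u by (auto simp: E_def atom_self)
      ultimately show ?thesis using u sum_atom_Ints two by blast
    qed
    have L2: "pairwise disjnt L"
    proof (rule pairwiseI)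
      fix D1 D2 assume D: "D1 \<in> L" "D2 \<in> L" "D1 \<noteq> D2"
      obtain u1 u2 where "D1 = atom u1" "D2 = atom u2" using D by (auto simp: L_def)
      then show "disjnt D1 D2" using atom_eq D(3) by (metis disjnt_iff)
    qed
    have "L \<subseteq> atom ` E" by (auto simp: L_def)
    then have L3: "finite L" using finE by (auto intro: finite_subset)
    have R: "card (D \<inter> E) \<ge> 2" if "D \<in> R" for D
      using that \<A>(1) \<B>(1) by (intro two) (auto simp: R_def)
    have R2: "pairwise disjnt R"
    proof (rule pairwiseI)
      fix D1 D2 assume D: "D1 \<in> R" "D2 \<in> R" "D1 \<noteq> D2"
      then show "disjnt D1 D2"
        using pairwiseD[OF \<A>(2), of D1 D2] pairwiseD[OF \<B>(2), of D1 D2] laminar[of D1 D2] laminar[of D2 D1]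
        unfolding R_def disjnt_def by blast
    qed
    have R3: "finite R" using fin\<A> fin\<B> by (simp add: R_def)
    obtain z0 :: "'a \<Rightarrow> real" where z0: "\<exists>u\<in>E. z0 u \<noteq> 0" "\<forall>D\<in>L \<union> R. sum z0 (D \<inter> E) = 0"
      using two_disjoint_families_nontrivial[OF finE E L L2 L3 R R2 R3] by blast
    define z where "z = (\<lambda>u. if u \<in> E then z0 u else 0)"
    have zsum: "sum z D = sum z0 (D \<inter> E)" if "D \<subseteq> F" for D
      unfolding z_def using that fin by (subst sum.inter_restrict) (auto intro: finite_subset)
    have z_LR: "sum z D = 0" if "D \<in> L \<union> R" "D \<subseteq> F" for D
      using z0 that zsum by simp
    have z_notE: "z u = 0" if "u \<notin> E" for u using that by (simp add: z_def)
    have z_tight: "sum z S = 0" if S: "tight S" for S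
    proof (rule sum_tight_eq_0[OF S])
      fix u assume u: "u \<in> S"
      have aF: "atom u \<subseteq> F" by (auto simp: atom_def)
      show "sum z (atom u) = 0"
      proof (cases "atom u \<inter> E = {}")
        case True
        then show ?thesis by (intro sum.neutral) (auto intro: z_notE)
      next
        case False
        then obtain e where e: "e \<in> atom u" "e \<in> E" by blast
        then have "e \<in> S" using atom_subset[OF S u] by blast
        then have "atom e \<in> L" using e S by (auto simp: L_def)
        then have "atom u \<in> L" using atom_eq[OF e(1)] by simp
        then show ?thesis using z_LR aF by blast
      qed
    qed
    have z_\<A>: "sum z A = 0" if A: "A \<in> \<A>" "sum y' A = 1" for A
    proof (cases "A \<inter> E = {}")
      case True
      then show ?thesis by (intro sum.neutral) (auto intro: z_notE)
    next
      case False
      then show ?thesis using A \<A>(1) by (intro z_LR) (auto simp: R_def)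
    qed
    have z_\<B>: "sum z B = 0" if B: "B \<in> \<B>" "sum y' B = 1" for B
    proof -
      consider "B \<inter> E = {}" | "B \<in> R" | A where "A \<in> \<A>" "A \<subseteq> B" "sum y' A = 1"
        using B by (auto simp: R_def)
      then show ?thesis
      proof cases
        case 1
        then show ?thesis by (intro sum.neutral) (auto intro: z_notE)
      next
        case 2
        then show ?thesis using B \<B>(1) by (intro z_LR) auto
      next
        case 3
        have finB: "finite B" using B \<B>(1) fin by (auto intro: finite_subset)
        \<comment> \<open>Both sets weigh 1, so the nonnegative \<open>y'\<close> vanishes on
          \<open>B - A\<close>. Its entries there are integers, where \<open>z\<close> is 0.\<close>
        have "sum y' (B - A) = 0" using sum_diff[OF finB 3(2), of y'] 3 B by simp
        then have "\<forall>u\<in>B - A. y' u = 0"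
          using finB feas(2) \<B>(1)[OF B(1)] by (subst (asm) sum_nonneg_eq_0_iff) auto
        then have "\<forall>u\<in>B - A. z u = 0" by (auto intro!: z_notE simp: E_def)
        then have "sum z (B - A) = 0" by simp
        then show ?thesis using sum_diff[OF finB 3(2), of z] z_\<A>[OF 3(1,3)] by simp
      qed
    qed
    have "\<forall>u\<in>F. z u = 0"
    proof (rule vertex)
      fix a b assume ab: "(a, b) \<in> C" and eq: "(\<Sum>u\<in>F. a u * y' u) = b"
      from ab consider
          S where "S \<subseteq> F" "a = ind S" "b = real (r S)"
        | u where "u \<in> F" "a = (\<lambda>v. - ind {u} v)" "b = 0"
        | A where "A \<in> \<A>" "a = ind A" "b = 1"
        | B where "B \<in> \<B>" "a = (\<lambda>v. - ind B v)" "b = -1"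
        unfolding C_def by blast
      then show "(\<Sum>u\<in>F. a u * z u) = 0"
      proof cases
        case 1
        then have "tight S" using eq ind[of S y'] by (simp add: tight_def)
        then show ?thesis using 1 ind[of S z] z_tight by simp
      next
        case 2
        then have "y' u = 0" using eq nsing[of u y'] by simp
        then have "z u = 0" by (intro z_notE) (simp add: E_def)
        then show ?thesis using 2 nsing[of u z] by simp
      next
        case 3
        then show ?thesis using eq ind[of A y'] ind[of A z] z_\<A>[of A] \<A>(1)[of A] by simp
      next
        case 4
        then show ?thesis using eq nind[of B y'] nind[of B z] z_\<B>[of B] \<B>(1)[of B] by simp
      qed
    qed
    then show False using z0(1) by (auto simp: z_def E_def)
  qed
  then have "\<forall>u\<in>F. y' u \<in> \<int>" by (auto simp: E_def)
  then show ?thesis using y' sat_iff[of y'] by (intro exI[of _ y']) blast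
qed

section \<open>Client consolidation\<close>

lemma consol_step_unaffected:
  "u \<noteq> vi \<Longrightarrow> u \<noteq> vj \<Longrightarrow> consol_step d p R vi vj w u = w u"
  by (simp add: consol_step_def)

lemma fold_consol_step_nonneg:
  "(\<And>u. u \<in> X \<Longrightarrow> w u \<ge> 0) \<Longrightarrow> vi \<in> X \<Longrightarrow> set vs \<subseteq> X \<Longrightarrow> u \<in> X \<Longrightarrow>
    fold (consol_step d p R vi) vs w u \<ge> 0"
proof (induction vs arbitrary: w)
  case (Cons vj vs)
  have "consol_step d p R vi vj w u \<ge> 0" if "u \<in> X" for u
    using Cons.prems that by (auto simp: consol_step_def)
  with Cons show ?case by simp
qed simp

lemma consolidate_nonneg:
  "(\<And>u. u \<in> X \<Longrightarrow> w u \<ge> 0) \<Longrightarrow> set vs \<subseteq> X \<Longrightarrow> u \<in> X \<Longrightarrow> consolidate d p R vs w u \<ge> 0"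
proof (induction vs arbitrary: w)
  case (Cons vi vs)
  have "fold (consol_step d p R vi) vs w u \<ge> 0" if "u \<in> X" for u
    using Cons.prems that by (intro fold_consol_step_nonneg[of X]) auto
  with Cons show ?case by simp
qed simp

lemma fold_consol_step_zero:
  "w u = 0 \<Longrightarrow> vi \<noteq> u \<Longrightarrow> fold (consol_step d p R vi) vs w u = 0"
proof (induction vs arbitrary: w)
  case (Cons vj vs)
  have "consol_step d p R vi vj w u = 0" using Cons.prems by (auto simp: consol_step_def)
  with Cons show ?case by simp
qed simp

lemma fold_consol_step_center_zero:
  "w vi = 0 \<Longrightarrow> fold (consol_step d p R vi) vs w = w"
  by (induction vs arbitrary: w) (auto simp: consol_step_def)

text \<open>Demand is received only in the role of \<open>vi\<close>, and the test requires
  \<open>w vi > 0\<close>, so a client once emptied stays empty.\<close>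

lemma consolidate_zero:
  "w u = 0 \<Longrightarrow> consolidate d p R vs w u = 0"
proof (induction vs arbitrary: w)
  case (Cons vi vs)
  have "fold (consol_step d p R vi) vs w u = 0"
    using Cons.prems by (cases "vi = u") (auto simp: fold_consol_step_zero fold_consol_step_center_zero)
  with Cons show ?case by simp
qed simp

text \<open>Absorbing demand keeps \<open>w vi\<close> positive, so the test still succeeds when
  \<open>vj\<close> is reached; the later steps of this fold leave \<open>vj\<close> at 0.\<close>

lemma fold_consol_step_absorbs:
  assumes "\<And>u. u \<in> X \<Longrightarrow> w u \<ge> 0" "vi \<in> X" "set vs \<subseteq> X" "vi \<notin> set vs" "w vi > 0"
    "vj \<in> set vs" "d vi vj \<le> 2 powr ((p + 1) / p) * R vj"
  shows "fold (consol_step d p R vi) vs w vj = 0"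
  using assms
proof (induction vs arbitrary: w)
  case (Cons vk vs)
  let ?w = "consol_step d p R vi vk w"
  have nn: "?w u \<ge> 0" if "u \<in> X" for u
    using Cons.prems that by (auto simp: consol_step_def)
  have pos: "?w vi > 0" using Cons.prems by (auto simp: consol_step_def add_pos_nonneg)
  show ?case
  proof (cases "vj \<in> set vs")
    case True
    then show ?thesis using Cons.IH[of ?w] nn pos Cons.prems by simp
  next
    case False
    then have "vj = vk" "vi \<noteq> vj" using Cons.prems by auto
    moreover have "?w vj = 0" using Cons.prems calculation by (auto simp: consol_step_def)
    ultimately show ?thesis by (simp add: fold_consol_step_zero)
  qed
qed simp

text \<open>Of two survivors, the earlier one in the list was still positive when it served as
  centre, yet did not absorb the later one. This gives the bound with the radius of the later one,
  which is the larger since the list is sorted by \<open>R\<close>.\<close>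

lemma consolidate_separated:
  assumes "\<And>u. u \<in> X \<Longrightarrow> w u \<ge> 0" "set vs \<subseteq> X" "distinct vs" "sorted (map R vs)"
    "u \<in> set vs" "v \<in> set vs" "u \<noteq> v" "consolidate d p R vs w u > 0" "consolidate d p R vs w v > 0"
    "\<And>a b. a \<in> X \<Longrightarrow> b \<in> X \<Longrightarrow> d a b = d b a"
  shows "d u v > 2 powr ((p + 1) / p) * R u"
  using assms(1-9)
proof (induction vs arbitrary: w)
  case (Cons vi vs)
  let ?w = "fold (consol_step d p R vi) vs w"
  have nn: "?w u \<ge> 0" if "u \<in> X" for u
    using Cons.prems that by (intro fold_consol_step_nonneg[of X]) auto
  have vipos: "w vi > 0" if "consolidate d p R (vi # vs) w vi > 0"
  proof (rule ccontr)
    assume "\<not> w vi > 0"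
    then have "w vi = 0" using Cons.prems(1)[of vi] Cons.prems(2) by auto
    then show False using that consolidate_zero[of w vi d p R "vi # vs"] by simp
  qed
  have far: "d vi b > 2 powr ((p + 1) / p) * R b"
    if "b \<in> set vs" "consolidate d p R (vi # vs) w vi > 0" "consolidate d p R (vi # vs) w b > 0" for b
  proof (rule ccontr)
    assume "\<not> ?thesis"
    then have "?w b = 0"
      using that vipos Cons.prems by (intro fold_consol_step_absorbs[of X]) auto
    then show False using that(3) by (simp add: consolidate_zero)
  qed
  consider "u = vi" | "v = vi" "u \<noteq> vi" | "u \<noteq> vi" "v \<noteq> vi" by blast
  then show ?case
  proof cases
    case 1
    then have "R u \<le> R v" "v \<in> set vs" using Cons.prems by auto
    then have "2 powr ((p + 1) / p) * R u \<le> 2 powr ((p + 1) / p) * R v" by simp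
    also have "\<dots> < d u v" using far[of v] 1 Cons.prems \<open>v \<in> set vs\<close> by auto
    finally show ?thesis .
  next
    case 2
    then show ?thesis using far[of u] Cons.prems assms(10)[of u v] by auto
  next
    case 3
    then show ?thesis using Cons.IH[of ?w] nn Cons.prems by simp
  qed
qed simp

text \<open>Demand moves only from some \<open>vj\<close> to \<open>vi\<close>, where
  \<open>g\<close> is no larger.\<close>

lemma fold_consol_step_weighted_sum_le:
  fixes g :: "'a \<Rightarrow> real"
  assumes "finite X" "\<And>u. u \<in> X \<Longrightarrow> w u \<ge> 0" "vi \<in> X" "set vs \<subseteq> X" "vi \<notin> set vs"
    "\<And>u. u \<in> set vs \<Longrightarrow> g vi \<le> g u"
  shows "(\<Sum>u\<in>X. fold (consol_step d p R vi) vs w u * g u) \<le> (\<Sum>u\<in>X. w u * g u)"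
  using assms(2-)
proof (induction vs arbitrary: w)
  case (Cons vj vs)
  let ?w = "consol_step d p R vi vj w"
  have nn: "?w u \<ge> 0" if "u \<in> X" for u
    using Cons.prems that by (auto simp: consol_step_def)
  have "(\<Sum>u\<in>X. ?w u * g u) \<le> (\<Sum>u\<in>X. w u * g u)"
  proof (cases "d vi vj \<le> 2 powr ((p + 1) / p) * R vj \<and> w vi > 0")
    case True
    have "X = insert vi (insert vj (X - {vi, vj}))" using Cons.prems by auto
    then have split: "(\<Sum>u\<in>X. h u) = h vi + h vj + (\<Sum>u\<in>X - {vi, vj}. h u)" for h :: "'a \<Rightarrow> real"
      using sum.insert[of "insert vj (X - {vi, vj})" vi h] sum.insert[of "X - {vi, vj}" vj h]
        assms(1) Cons.prems by simp
    have "(\<Sum>u\<in>X - {vi, vj}. ?w u * g u) = (\<Sum>u\<in>X - {vi, vj}. w u * g u)"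
      by (intro sum.cong) (auto simp: consol_step_unaffected)
    moreover have "w vj * g vi \<le> w vj * g vj"
      using Cons.prems by (intro mult_left_mono) auto
    ultimately show ?thesis
      using True Cons.prems(4) by (auto simp: split consol_step_def algebra_simps)
  next
    case False
    then show ?thesis by (auto simp: consol_step_def)
  qed
  moreover have "(\<Sum>u\<in>X. fold (consol_step d p R vi) vs ?w u * g u) \<le> (\<Sum>u\<in>X. ?w u * g u)"
    using Cons.prems nn by (intro Cons.IH) auto
  ultimately show ?case by simp
qed simp

text \<open>Applied with \<open>g\<close> the fractional connection cost per unit of demand:
  consolidation does not raise the total connection cost.\<close>

lemma consolidate_weighted_sum_le:
  fixes g :: "'a \<Rightarrow> real"
  assumes "finite X" "\<And>u. u \<in> X \<Longrightarrow> w u \<ge> 0" "set vs \<subseteq> X" "distinct vs" "sorted (map g vs)"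
  shows "(\<Sum>u\<in>X. consolidate d p R vs w u * g u) \<le> (\<Sum>u\<in>X. w u * g u)"
  using assms(2-)
proof (induction vs arbitrary: w)
  case (Cons vi vs)
  let ?w = "fold (consol_step d p R vi) vs w"
  have nn: "?w u \<ge> 0" if "u \<in> X" for u
    using Cons.prems that by (intro fold_consol_step_nonneg[of X]) auto
  have "(\<Sum>u\<in>X. ?w u * g u) \<le> (\<Sum>u\<in>X. w u * g u)"
    using Cons.prems assms(1) by (intro fold_consol_step_weighted_sum_le) auto
  moreover have "(\<Sum>u\<in>X. consolidate d p R vs ?w u * g u) \<le> (\<Sum>u\<in>X. ?w u * g u)"
    using Cons.prems nn by (intro Cons.IH) auto
  ultimately show ?case by simp
qed simp

section \<open>Rounding the fractional solution\<close>

text \<open>Scan \<open>S\<close> by increasing \<open>a\<close> and keep a pair if it meets no pair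
  kept before; a rejected pair is blocked by a kept one of no larger \<open>a\<close>.\<close>

lemma greedy_disjoint_pairs:
  fixes a :: "'a \<Rightarrow> 'b::linorder"
  assumes "finite S"
  shows "\<exists>T\<subseteq>S. (\<forall>s\<in>T. \<forall>t\<in>T. s \<noteq> t \<longrightarrow> {s, n s} \<inter> {t, n t} = {}) \<and>
    (\<forall>v\<in>S. \<exists>s\<in>T. a s \<le> a v \<and> {v, n v} \<inter> {s, n s} \<noteq> {})"
  using assms
proof (induction S rule: finite_ranking_induct[where f = a])
  case empty
  then show ?case by auto
next
  case (insert v S)
  then obtain T where T: "T \<subseteq> S" "\<forall>s\<in>T. \<forall>t\<in>T. s \<noteq> t \<longrightarrow> {s, n s} \<inter> {t, n t} = {}"
    "\<forall>v\<in>S. \<exists>s\<in>T. a s \<le> a v \<and> {v, n v} \<inter> {s, n s} \<noteq> {}" by blast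
  show ?case
  proof (cases "\<exists>s\<in>T. {v, n v} \<inter> {s, n s} \<noteq> {}")
    case True
    then show ?thesis using T insert.hyps by (intro exI[of _ T]) blast
  next
    case False
    have "\<forall>u\<in>insert v S. \<exists>s\<in>insert v T. a s \<le> a u \<and> {u, n u} \<inter> {s, n s} \<noteq> {}"
      using T(3) by blast
    moreover have "{s, n s} \<inter> {t, n t} = {}"
      if st: "s \<in> insert v T" "t \<in> insert v T" "s \<noteq> t" for s t
    proof -
      consider "s = v" "t \<in> T" | "t = v" "s \<in> T" | "s \<in> T" "t \<in> T" using st by blast
      then show ?thesis
      proof cases
        case 1 then show ?thesis using False by blast
      next
        case 2 then show ?thesis using False by blast
      next
        case 3 then show ?thesis using T(2) st(3) by blast
      qed
    qed
    moreover have "insert v T \<subseteq> insert v S" using T(1) by blast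
    ultimately show ?thesis by (intro exI[of _ "insert v T"] conjI) simp_all
  qed
qed

text \<open>Each unit of \<open>\<xi>\<close> outside \<open>B\<close> costs at least
  \<open>\<rho> powr p\<close>. This is Markov's inequality with the cost inside the ball
  retained.\<close>

lemma truncated_cost_le:
  fixes \<delta> \<xi> :: "'a \<Rightarrow> real"
  assumes "finite F" "p \<ge> 0" "\<rho> \<ge> 0" "\<And>u. u \<in> F \<Longrightarrow> \<xi> u \<ge> 0" "sum \<xi> F = 1"
  defines "B \<equiv> {u\<in>F. \<delta> u < \<rho>}"
  shows "(\<Sum>u\<in>B. \<delta> u powr p * \<xi> u) + (1 - sum \<xi> B) * \<rho> powr p \<le> (\<Sum>u\<in>F. \<delta> u powr p * \<xi> u)"
proof -
  have B: "B \<subseteq> F" by (auto simp: B_def)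
  have "1 - sum \<xi> B = sum \<xi> (F - B)" using sum_diff[OF assms(1) B, of \<xi>] assms(5) by simp
  then have "(1 - sum \<xi> B) * \<rho> powr p = (\<Sum>u\<in>F - B. \<rho> powr p * \<xi> u)"
    by (simp add: sum_distrib_left mult.commute)
  also have "\<dots> \<le> (\<Sum>u\<in>F - B. \<delta> u powr p * \<xi> u)"
    using assms(2-4) by (intro sum_mono mult_right_mono powr_mono2) (auto simp: B_def)
  also have "\<dots> = (\<Sum>u\<in>F. \<delta> u powr p * \<xi> u) - (\<Sum>u\<in>B. \<delta> u powr p * \<xi> u)"
    using sum_diff[OF assms(1) B] by blast
  finally show ?thesis by simp
qed

lemma nearest_other:
  fixes \<delta> :: "'a \<Rightarrow> real"
  assumes "finite Q" "card Q \<ge> 2"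
  shows "\<exists>u\<in>Q. u \<noteq> v \<and> (\<forall>t\<in>Q. t \<noteq> v \<longrightarrow> \<delta> u \<le> \<delta> t)"
proof -
  have "Q - {v} \<noteq> {}"
  proof
    assume "Q - {v} = {}"
    then have "card Q \<le> card {v}" by (intro card_mono) auto
    then show False using assms by simp
  qed
  then show ?thesis
    using arg_min_if_finite(1)[of "Q - {v}" \<delta>] arg_min_least[of "Q - {v}" _ \<delta>] assms(1) by blast
qed

theorem mainTheorem19:
  fixes P F :: "'a set" and d :: "'a \<Rightarrow> 'a \<Rightarrow> real" and p :: real
    and f w :: "'a \<Rightarrow> real" and indep :: "'a set \<Rightarrow> bool"
    and x :: "'a \<Rightarrow> 'a \<Rightarrow> real" and y :: "'a \<Rightarrow> real" and vs :: "'a list"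
  assumes p: "p \<ge> 1"
    and metric: "finite_metric_on (P \<union> F) d"
    and f_nonneg: "\<forall>u\<in>F. f u \<ge> 0"
    and w_nonneg: "\<forall>v\<in>P. w v \<ge> 0"
    and M: "matroid F indep"
    and opt: "fml_optimal P F d p f w indep x y"
    and sum_one: "\<forall>v\<in>P. (\<Sum>u\<in>F. x v u) = 1"
    and order: "distinct vs" "set vs = P"
      "sorted (map (conn_radius F d p x) vs)"
    and supp: "card {v\<in>P. consolidate d p (conn_radius F d p x) vs w v > 0} \<ge> 2"
  shows "\<exists>x' y'. fml_feasible P F indep x' y' \<and> fml_integral P F x' y' \<and>
           fml_cost P F d p f (consolidate d p (conn_radius F d p x) vs w) x' y'
             \<le> (4 * 3 powr (p - 1) + 2) * 3 powr p * fml_cost P F d p f w x y"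
proof -

  \<comment> \<open>Demands after consolidation\<close>
  define R where "R = conn_radius F d p x"
  define w' where "w' = consolidate d p R vs w"
  define Q where "Q = {v\<in>P. w' v > 0}"
  \<comment> \<open>The connection cost per unit of demand, which equals \<open>R v powr p\<close>
    for \<open>v\<close> in \<open>P\<close>.\<close>
  define G where "G = (\<lambda>v. \<Sum>u\<in>F. d v u powr p * x v u)"
  have finP: "finite P" and finF: "finite F" using metric by (auto simp: finite_metric_on_def)
  have d_nonneg: "d s t \<ge> 0" and d_sym: "d s t = d t s" and d_zero: "d s t = 0 \<longleftrightarrow> s = t"
    if "s \<in> P \<union> F" "t \<in> P \<union> F" for s t
    using metric that by (auto simp: finite_metric_on_def)
  have tri: "d s t \<le> d s q + d q t" if "s \<in> P \<union> F" "q \<in> P \<union> F" "t \<in> P \<union> F" for s q t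
    using metric that unfolding finite_metric_on_def by blast
  have feas: "sum y S \<le> real (mrank indep S)" if "S \<subseteq> F" for S
    using opt that by (auto simp: fml_optimal_def fml_feasible_def)
  have x: "0 \<le> x v u" "x v u \<le> y u" if "v \<in> P" "u \<in> F" for v u
    using opt that by (auto simp: fml_optimal_def fml_feasible_def)
  have G_nonneg: "G v \<ge> 0" if "v \<in> P" for v
    unfolding G_def using x that by (intro sum_nonneg mult_nonneg_nonneg) auto
  have R_nonneg: "R v \<ge> 0" for v by (simp add: R_def conn_radius_def)
  have RG: "R v powr p = G v" if "v \<in> P" for v
    using p G_nonneg[OF that] by (simp add: R_def conn_radius_def G_def powr_powr)
  have w'_nonneg: "w' v \<ge> 0" if "v \<in> P" for v
    unfolding w'_def using w_nonneg order that by (intro consolidate_nonneg[of P]) auto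
  have Q: "Q \<subseteq> P" "finite Q" "card Q \<ge> 2"
    using finP supp by (auto simp: Q_def w'_def R_def)
  have QP: "v \<in> P" if "v \<in> Q" for v using Q that by blast
  have far: "d u v > 2 powr ((p + 1) / p) * R u" if "u \<in> Q" "v \<in> Q" "u \<noteq> v" for u v
    using that w_nonneg order d_sym unfolding Q_def w'_def
    by (intro consolidate_separated[of P w vs]) (auto simp: R_def)
  have w'G: "(\<Sum>v\<in>P. w' v * G v) \<le> (\<Sum>v\<in>P. w v * G v)"
  proof -
    \<comment> \<open>The list sorted by \<open>R\<close> is also sorted by \<open>G\<close>, since
      taking \<open>p\<close>-th powers is monotone.\<close>
    have "sorted_wrt (\<lambda>u v. G u \<le> G v) vs"
    proof (rule sorted_wrt_mono_rel)
      show "sorted_wrt (\<lambda>u v. R u \<le> R v) vs" using order by (simp add: R_def sorted_map)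
      show "G u \<le> G v" if "u \<in> set vs" "v \<in> set vs" "R u \<le> R v" for u v
        using powr_mono2[of p "R u" "R v"] that p R_nonneg RG order by auto
    qed
    then show ?thesis unfolding w'_def using finP w_nonneg order
      by (intro consolidate_weighted_sum_le) (auto simp: sorted_map)
  qed

  \<comment> \<open>Disjoint balls around the support\<close>
  obtain n where n: "\<And>v. v \<in> Q \<Longrightarrow> n v \<in> Q" "\<And>v. v \<in> Q \<Longrightarrow> n v \<noteq> v"
    and n_min: "\<And>v t. v \<in> Q \<Longrightarrow> t \<in> Q \<Longrightarrow> t \<noteq> v \<Longrightarrow> d v (n v) \<le> d v t"
  proof -
    have "\<forall>v\<in>Q. \<exists>u. u \<in> Q \<and> u \<noteq> v \<and> (\<forall>t\<in>Q. t \<noteq> v \<longrightarrow> d v u \<le> d v t)"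
      using nearest_other[OF Q(2,3)] by blast
    from bchoice[OF this] show ?thesis using that by blast
  qed
  define \<rho> where "\<rho> = (\<lambda>v. d v (n v) / 2)"
  define ball where "ball = (\<lambda>v. {u\<in>F. d v u < \<rho> v})"
  have ballF: "ball v \<subseteq> F" "finite (ball v)" for v using finF by (auto simp: ball_def)
  have \<rho>_pos: "\<rho> v > 0" if "v \<in> Q" for v
  proof -
    have "v \<in> P \<union> F" "n v \<in> P \<union> F" "n v \<noteq> v" using n QP that by auto
    then show ?thesis using d_nonneg[of v "n v"] d_zero[of v "n v"] by (auto simp: \<rho>_def less_le)
  qed
  have \<rho>_min: "2 * \<rho> v \<le> d v t" if "v \<in> Q" "t \<in> Q" "t \<noteq> v" for v t
    using n_min[OF that] by (simp add: \<rho>_def)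
  have disj: "ball v \<inter> ball t = {}" if vt: "v \<in> Q" "t \<in> Q" "v \<noteq> t" for v t
  proof (rule ccontr)
    assume "ball v \<inter> ball t \<noteq> {}"
    then obtain u where u: "u \<in> F" "d v u < \<rho> v" "d t u < \<rho> t" by (auto simp: ball_def)
    have "d v t \<le> d v u + d u t" using tri u vt QP by blast
    moreover have "d u t = d t u" "d v t = d t v" using d_sym u vt QP by blast+
    moreover have "2 * \<rho> v \<le> d v t" "2 * \<rho> t \<le> d t v" using \<rho>_min vt by auto
    ultimately show False using u by linarith
  qed
  have trunc: "(\<Sum>u\<in>ball v. d v u powr p * x v u) + (1 - sum (x v) (ball v)) * \<rho> v powr p \<le> G v"
    if "v \<in> Q" for v
    unfolding G_def ball_def using p finF \<rho>_pos[OF that] x QP[OF that] sum_one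
    by (intro truncated_cost_le) auto
  have half: "sum (x v) (ball v) \<ge> 1 / 2" if v: "v \<in> Q" for v
  proof -
    \<comment> \<open>Raised to the power \<open>p\<close>, the consolidation factor becomes
      \<open>2 powr (p + 1)\<close>, so the separation of \<open>v\<close> from \<open>n v\<close>
      yields \<open>2 * G v \<le> \<rho> v powr p\<close>. By \<open>trunc\<close>, at most half of
      the assignment of \<open>v\<close> then lies outside its ball.\<close>
    have "2 powr ((p + 1) / p) * R v \<le> 2 * \<rho> v"
      using far[of v "n v"] n v by (force simp: \<rho>_def)
    then have "(2 powr ((p + 1) / p) * R v) powr p \<le> (2 * \<rho> v) powr p"
      using p R_nonneg by (intro powr_mono2) auto
    then have "2 powr (p + 1) * G v \<le> 2 powr p * \<rho> v powr p"
      using p R_nonneg \<rho>_pos[OF v] RG QP[OF v] by (simp add: powr_mult powr_powr)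
    then have "2 powr p * (2 * G v) \<le> 2 powr p * \<rho> v powr p" by (simp add: powr_add)
    then have "2 * G v \<le> \<rho> v powr p" by simp
    moreover have "(\<Sum>u\<in>ball v. d v u powr p * x v u) \<ge> 0"
      using x QP[OF v] by (intro sum_nonneg mult_nonneg_nonneg) (auto simp: ball_def)
    ultimately have "2 * (1 - sum (x v) (ball v)) * \<rho> v powr p \<le> 1 * \<rho> v powr p"
      using trunc[OF v] by linarith
    then have "2 * (1 - sum (x v) (ball v)) \<le> 1"
      using \<rho>_pos[OF v] by (subst (asm) mult_le_cancel_right_pos) auto
    then show ?thesis by simp
  qed

  \<comment> \<open>Nearest-neighbour pairs and restricted facility weights\<close>
  obtain T where T: "T \<subseteq> Q"
    and T_disj: "\<forall>s\<in>T. \<forall>t\<in>T. s \<noteq> t \<longrightarrow> {s, n s} \<inter> {t, n t} = {}"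
    and T_cover: "\<forall>v\<in>Q. \<exists>s\<in>T. \<rho> s \<le> \<rho> v \<and> {v, n v} \<inter> {s, n s} \<noteq> {}"
    using greedy_disjoint_pairs[OF Q(2), of n \<rho>] by (elim exE conjE) (rule that)
  define pair where "pair = (\<lambda>s. ball s \<union> ball (n s))"
  \<comment> \<open>Balls of distinct clients are disjoint, so \<open>SOME\<close> has only one
    candidate. Facilities outside all balls get weight 0.\<close>
  define y1 where "y1 = (\<lambda>u. if \<exists>v\<in>Q. u \<in> ball v then x (SOME v. v \<in> Q \<and> u \<in> ball v) u else 0)"
  have y1_ball: "y1 u = x v u" if v: "v \<in> Q" "u \<in> ball v" for u v
  proof -
    have "(SOME v. v \<in> Q \<and> u \<in> ball v) = v"
      using v disj by (intro some_equality) blast+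
    then show ?thesis using v by (auto simp: y1_def)
  qed
  have y_nonneg: "y u \<ge> 0" if "u \<in> F" for u
  proof -
    have "Q \<noteq> {}" using Q(3) by auto
    then obtain v where "v \<in> Q" by blast
    then show ?thesis using x[of v u] QP that by (meson order_trans)
  qed
  have y1: "0 \<le> y1 u \<and> y1 u \<le> y u" if "u \<in> F" for u
  proof (cases "\<exists>v\<in>Q. u \<in> ball v")
    case True
    then show ?thesis using y1_ball x QP that by force
  next
    case False
    then show ?thesis using y_nonneg that by (auto simp: y1_def)
  qed
  have y1_sum: "sum y1 (ball v) = sum (x v) (ball v)" if "v \<in> Q" for v
    using y1_ball that by (intro sum.cong) auto

  \<comment> \<open>Linear cost for the rounding\<close>
  define c where "c = (\<lambda>u. f u + (\<Sum>v\<in>Q. if u \<in> ball v then w' v * (d v u powr p - \<rho> v powr p) else 0))"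
  \<comment> \<open>The charge per unit of demand at \<open>v\<close>: weight in the ball pays its
    distance, missing weight pays \<open>\<rho> v powr p\<close>. This is affine in
    \<open>z\<close>; \<open>c\<close> collects the linear part together with the opening costs, and
    \<open>k0\<close> is the constant. Coefficients of \<open>c\<close> may be negative, which the
    rounding theorem permits.\<close>
  define K where "K = (\<lambda>z v. (\<Sum>u\<in>ball v. d v u powr p * z u) + (1 - sum z (ball v)) * \<rho> v powr p)"
  define k0 where "k0 = (\<Sum>v\<in>Q. w' v * \<rho> v powr p)"
  have c_sum: "(\<Sum>u\<in>F. c u * z u) + k0 = (\<Sum>u\<in>F. f u * z u) + (\<Sum>v\<in>Q. w' v * K z v)" for z
  proof -
    have "(\<Sum>u\<in>F. c u * z u) = (\<Sum>u\<in>F. f u * z u) +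
        (\<Sum>u\<in>F. \<Sum>v\<in>Q. if u \<in> ball v then w' v * (d v u powr p - \<rho> v powr p) * z u else 0)"
      by (simp add: c_def distrib_right sum.distrib sum_distrib_right if_distrib[of "\<lambda>t. t * _"] cong: if_cong)
    also have "(\<Sum>u\<in>F. \<Sum>v\<in>Q. if u \<in> ball v then w' v * (d v u powr p - \<rho> v powr p) * z u else 0)
      = (\<Sum>v\<in>Q. \<Sum>u\<in>F. if u \<in> ball v then w' v * (d v u powr p - \<rho> v powr p) * z u else 0)"
      by (rule sum.swap)
    also have "\<dots> = (\<Sum>v\<in>Q. \<Sum>u\<in>ball v. w' v * (d v u powr p - \<rho> v powr p) * z u)"
    proof (rule sum.cong[OF refl])
      fix v
      show "(\<Sum>u\<in>F. if u \<in> ball v then w' v * (d v u powr p - \<rho> v powr p) * z u else 0)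
        = (\<Sum>u\<in>ball v. w' v * (d v u powr p - \<rho> v powr p) * z u)"
        using sum.inter_restrict[OF finF, of "\<lambda>u. w' v * (d v u powr p - \<rho> v powr p) * z u" "ball v"]
          ballF(1)[of v] by (simp add: Int_absorb1)
    qed
    also have "\<dots> = (\<Sum>v\<in>Q. w' v * K z v - w' v * \<rho> v powr p)"
      by (intro sum.cong refl)
        (simp add: K_def algebra_simps sum_subtractf sum_distrib_left sum_distrib_right)
    also have "\<dots> = (\<Sum>v\<in>Q. w' v * K z v) - k0" by (simp add: sum_subtractf k0_def)
    finally show ?thesis by simp
  qed

  \<comment> \<open>Integral opening of facilities\<close>
  have "\<exists>y' :: 'a \<Rightarrow> real. (\<forall>u\<in>F. y' u \<ge> 0 \<and> y' u \<in> \<int>) \<and>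
    (\<forall>S. S \<subseteq> F \<longrightarrow> sum y' S \<le> real (mrank indep S)) \<and> (\<forall>A\<in>ball ` Q. sum y' A \<le> 1) \<and>
    (\<forall>B\<in>pair ` T. sum y' B \<ge> 1) \<and> (\<Sum>u\<in>F. c u * y' u) \<le> (\<Sum>u\<in>F. c u * y1 u)"
  proof (rule submodular_laminar_rounding)
    show "pairwise disjnt (ball ` Q)"
      using disj by (auto simp: pairwise_def disjnt_def)
    show "pairwise disjnt (pair ` T)"
    proof (rule pairwiseI)
      fix B1 B2 assume B: "B1 \<in> pair ` T" "B2 \<in> pair ` T" "B1 \<noteq> B2"
      then obtain s t where st: "s \<in> T" "t \<in> T" "B1 = pair s" "B2 = pair t" "s \<noteq> t" by blast
      then have "s \<in> Q" "t \<in> Q" "n s \<in> Q" "n t \<in> Q" using T n by auto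
      moreover have "s \<noteq> n t" "n s \<noteq> t" "n s \<noteq> n t" using T_disj[rule_format, OF st(1,2,5)] by auto
      ultimately show "disjnt B1 B2"
        using disj[of s t] disj[of s "n t"] disj[of "n s" t] disj[of "n s" "n t"] st
        unfolding disjnt_def pair_def by blast
    qed
    show "A \<subseteq> B \<or> A \<inter> B = {}" if AB: "A \<in> ball ` Q" "B \<in> pair ` T" for A B
    proof -
      obtain v s where vs: "v \<in> Q" "s \<in> T" "A = ball v" "B = pair s" using AB by blast
      then have "s \<in> Q" "n s \<in> Q" using T n by auto
      then show ?thesis using vs disj[of v s] disj[of v "n s"] unfolding pair_def by blast
    qed
    show "sum y1 S \<le> real (mrank indep S)" if "S \<subseteq> F" for S
    proof -
      have "sum y1 S \<le> sum y S" using y1 that by (intro sum_mono) auto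
      then show ?thesis using feas[OF that] by linarith
    qed
    show "sum y1 A \<le> 1" if A: "A \<in> ball ` Q" for A
    proof -
      obtain v where v: "v \<in> Q" "A = ball v" using A by blast
      have "sum (x v) (ball v) \<le> sum (x v) F"
        using finF ballF x QP v by (intro sum_mono2) auto
      then show ?thesis using y1_sum v sum_one QP by simp
    qed
    show "sum y1 B \<ge> 1" if B: "B \<in> pair ` T" for B
    proof -
      obtain s where s: "s \<in> T" "B = pair s" using B by blast
      then have sQ: "s \<in> Q" "n s \<in> Q" "s \<noteq> n s" using T n by force+
      \<comment> \<open>Each of the two disjoint balls contributes at least one half.\<close>
      have "sum y1 B = sum y1 (ball s) + sum y1 (ball (n s))"
        unfolding s(2) pair_def using disj sQ ballF by (intro sum.union_disjoint) auto
      then show ?thesis using y1_sum[of s] y1_sum[of "n s"] half[of s] half[of "n s"] sQ by simp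
    qed
  qed (use finF ballF y1 mrank_empty[OF M] mrank_submodular[OF M] in \<open>auto simp: pair_def\<close>)
  then obtain y2 :: "'a \<Rightarrow> real" where y2_int: "\<forall>u\<in>F. y2 u \<ge> 0 \<and> y2 u \<in> \<int>"
    and y2_rank: "\<forall>S. S \<subseteq> F \<longrightarrow> sum y2 S \<le> real (mrank indep S)"
    and y2_balls: "\<forall>A\<in>ball ` Q. sum y2 A \<le> 1" and y2_pairs: "\<forall>B\<in>pair ` T. sum y2 B \<ge> 1"
    and y2_cost: "(\<Sum>u\<in>F. c u * y2 u) \<le> (\<Sum>u\<in>F. c u * y1 u)"
    by (elim exE conjE) (rule that)
  have y2: "y2 u \<ge> 0" "y2 u \<in> \<int>" if "u \<in> F" for u using y2_int that by auto
  have y2_ball: "sum y2 (ball v) \<le> 1" if "v \<in> Q" for v using y2_balls that by blast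
  have y2_pair: "sum y2 (pair s) \<ge> 1" if "s \<in> T" for s using y2_pairs that by blast
  have y2_ge1: "y2 u \<ge> 1" if "u \<in> F" "y2 u \<noteq> 0" for u
    using y2[OF that(1)] that(2) by (auto elim!: Ints_cases)
  have open_pair: "\<exists>u\<in>pair s. u \<in> F \<and> y2 u \<ge> 1" if "s \<in> T" for s
  proof -
    have "\<exists>u\<in>pair s. y2 u \<noteq> 0"
    proof (rule ccontr)
      assume "\<not> ?thesis"
      then have "sum y2 (pair s) = 0" by simp
      then show False using y2_pair[OF that] by simp
    qed
    then show ?thesis using y2_ge1 ballF by (force simp: pair_def)
  qed

  \<comment> \<open>Distance to an open facility\<close>
  have near: "\<exists>u\<in>F. y2 u \<ge> 1 \<and> d v u powr p \<le> 5 powr p * K y2 v" if v: "v \<in> Q" for v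
  proof (cases "\<exists>u\<in>ball v. y2 u \<noteq> 0")
    case True
    then obtain u where u: "u \<in> ball v" "y2 u \<noteq> 0" by blast
    then have uF: "u \<in> F" "y2 u \<ge> 1" using y2_ge1 ballF by blast+
    have nn: "0 \<le> d v t powr p * y2 t" if "t \<in> ball v" for t
      using y2(1) that by (intro mult_nonneg_nonneg) (auto simp: ball_def)
    \<comment> \<open>The ball holds weight at most 1, so the penalty term of \<open>K y2 v\<close>
      is nonnegative and \<open>K y2 v\<close> dominates the cost of reaching
      \<open>u\<close>.\<close>
    have "d v u powr p * 1 \<le> d v u powr p * y2 u" using uF by (intro mult_left_mono) auto
    also have "\<dots> \<le> (\<Sum>t\<in>ball v. d v t powr p * y2 t)"
      using u ballF nn by (intro member_le_sum) auto
    also have "\<dots> \<le> K y2 v" unfolding K_def using y2_ball[OF v] by simp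
    finally have 1: "d v u powr p \<le> K y2 v" by simp
    moreover have "1 \<le> (5::real) powr p" using p by (intro ge_one_powr_ge_zero) auto
    moreover have "0 \<le> d v u powr p" by simp
    ultimately have "1 * K y2 v \<le> 5 powr p * K y2 v" by (intro mult_right_mono) linarith+
    then show ?thesis using 1 uF by (intro bexI[of _ u]) auto
  next
    case False
    then have "K y2 v = \<rho> v powr p" by (simp add: K_def)
    \<comment> \<open>The route from \<open>v\<close> goes to a point \<open>m\<close> shared with
      the blocking pair, on to the centre \<open>q\<close> in that pair whose ball contains an open
      facility \<open>u\<close>, and then to \<open>u\<close>. The three legs are at most
      \<open>2 * \<rho> v\<close>, \<open>2 * \<rho> s\<close> and \<open>\<rho> s\<close>, and
      \<open>\<rho> s \<le> \<rho> v\<close>.\<close>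
    obtain s m where s: "s \<in> T" "\<rho> s \<le> \<rho> v" "m \<in> {v, n v}" "m \<in> {s, n s}"
      using bspec[OF T_cover v] by blast
    obtain u where u: "u \<in> pair s" "u \<in> F" "y2 u \<ge> 1" using open_pair[OF s(1)] by blast
    then obtain q where q: "q \<in> {s, n s}" "u \<in> ball q" by (auto simp: pair_def)
    have sQ: "s \<in> Q" using s T by blast
    have inP: "v \<in> P" "m \<in> P" "q \<in> P" using s q n v sQ QP by auto
    have d0: "d t t = 0" if "t \<in> P" for t using d_zero[of t t] that by simp
    have vm: "d v m \<le> 2 * \<rho> v" using s(3) d0 inP \<rho>_pos[OF v] by (auto simp: \<rho>_def)
    have "d (n s) s = d s (n s)" using d_sym sQ n QP by blast
    then have mq: "d m q \<le> 2 * \<rho> s" using s(4) q(1) d0 inP \<rho>_pos[OF sQ] by (auto simp: \<rho>_def)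
    \<comment> \<open>\<open>s\<close> is itself a candidate for the nearest neighbour of
      \<open>n s\<close>, so either centre of the pair has radius at most
      \<open>\<rho> s\<close>.\<close>
    have "\<rho> (n s) \<le> \<rho> s"
      using \<rho>_min[of "n s" s] n[OF sQ] sQ \<open>d (n s) s = d s (n s)\<close> by (auto simp: \<rho>_def)
    then have "\<rho> q \<le> \<rho> s" using q by auto
    then have qu: "d q u \<le> \<rho> s" using q by (auto simp: ball_def)
    have "d v u \<le> d v m + d m u" "d m u \<le> d m q + d q u" using tri inP u by blast+
    then have "d v u \<le> 5 * \<rho> v" using vm mq qu s(2) by linarith
    then have "d v u powr p \<le> (5 * \<rho> v) powr p"
      using p d_nonneg[of v u] inP u by (intro powr_mono2) auto
    also have "\<dots> = 5 powr p * K y2 v"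
      using \<open>K y2 v = _\<close> \<rho>_pos[OF v] by (simp add: powr_mult)
    finally show ?thesis using u by blast
  qed
  \<comment> \<open>Feasibility requires an assignment for every client. Clients outside
    \<open>Q\<close> carry no consolidated demand, so any open facility serves them; one exists
    because \<open>T\<close> is nonempty.\<close>
  have "\<exists>u. u \<in> F \<and> y2 u \<ge> 1 \<and> (v \<in> Q \<longrightarrow> d v u powr p \<le> 5 powr p * K y2 v)" for v
  proof (cases "v \<in> Q")
    case True
    then show ?thesis using near by blast
  next
    case False
    have "Q \<noteq> {}" using Q(3) by auto
    then obtain s where "s \<in> T" using T_cover by blast
    then show ?thesis using open_pair False by blast
  qed
  then obtain \<sigma> where \<sigma>: "\<And>v. \<sigma> v \<in> F" "\<And>v. y2 (\<sigma> v) \<ge> 1"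
    "\<And>v. v \<in> Q \<Longrightarrow> d v (\<sigma> v) powr p \<le> 5 powr p * K y2 v" by metis

  \<comment> \<open>Feasibility and cost of the integral solution\<close>
  define x2 :: "'a \<Rightarrow> 'a \<Rightarrow> real" where "x2 = (\<lambda>v u. if u = \<sigma> v then 1 else 0)"
  have "fml_feasible P F indep x2 y2"
    unfolding fml_feasible_def using \<sigma> finF y2 y2_rank by (auto simp: x2_def)
  moreover have "fml_integral P F x2 y2"
    unfolding fml_integral_def using y2 by (auto simp: x2_def)
  moreover have "fml_cost P F d p f w' x2 y2 \<le> (4 * 3 powr (p - 1) + 2) * 3 powr p * fml_cost P F d p f w x y"
  proof -
    have QsumP: "(\<Sum>v\<in>P. w' v * g v) = (\<Sum>v\<in>Q. w' v * g v)" for g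
      using finP Q(1) w'_nonneg by (intro sum.mono_neutral_right) (auto simp: Q_def less_le)
    have cost_w: "fml_cost P F d p f w x y = (\<Sum>u\<in>F. f u * y u) + (\<Sum>v\<in>P. w v * G v)"
      by (simp add: fml_cost_def G_def sum_distrib_left mult.assoc)
    have five: "1 \<le> (5::real) powr p" using p by (intro ge_one_powr_ge_zero) auto
    have f2: "(\<Sum>u\<in>F. f u * y2 u) \<ge> 0" using f_nonneg y2 by (intro sum_nonneg) auto
    have "(\<Sum>u\<in>F. w' v * d v u powr p * x2 v u) = w' v * d v (\<sigma> v) powr p" for v
      using \<sigma> finF by (simp add: x2_def if_distrib[of "\<lambda>t. _ * t"] cong: if_cong)
    then have "fml_cost P F d p f w' x2 y2 = (\<Sum>u\<in>F. f u * y2 u) + (\<Sum>v\<in>P. w' v * d v (\<sigma> v) powr p)"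
      by (simp add: fml_cost_def)
    also have "\<dots> = (\<Sum>u\<in>F. f u * y2 u) + (\<Sum>v\<in>Q. w' v * d v (\<sigma> v) powr p)"
      by (simp add: QsumP)
    \<comment> \<open>Opening costs are scaled up as well, so that \<open>5 powr p\<close> becomes a
      common factor of the linear cost.\<close>
    also have "\<dots> \<le> 5 powr p * (\<Sum>u\<in>F. f u * y2 u) + (\<Sum>v\<in>Q. w' v * (5 powr p * K y2 v))"
      using f2 five \<sigma> by (intro add_mono sum_mono mult_left_mono) (auto simp: mult_le_cancel_right1 Q_def)
    also have "\<dots> = 5 powr p * ((\<Sum>u\<in>F. c u * y2 u) + k0)"
      by (simp add: c_sum distrib_left sum_distrib_left mult_ac)
    also have "\<dots> \<le> 5 powr p * ((\<Sum>u\<in>F. c u * y1 u) + k0)"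
      using y2_cost by (intro mult_left_mono) auto
    also have "\<dots> = 5 powr p * ((\<Sum>u\<in>F. f u * y1 u) + (\<Sum>v\<in>Q. w' v * K y1 v))"
      by (simp add: c_sum)
    also have "\<dots> \<le> 5 powr p * ((\<Sum>u\<in>F. f u * y u) + (\<Sum>v\<in>Q. w' v * G v))"
    proof (intro mult_left_mono add_mono sum_mono)
      fix v assume v: "v \<in> Q"
      have "(\<Sum>u\<in>ball v. d v u powr p * y1 u) = (\<Sum>u\<in>ball v. d v u powr p * x v u)"
        using y1_ball v by (intro sum.cong) auto
      then show "K y1 v \<le> G v" using trunc[OF v] y1_sum[OF v] by (simp add: K_def)
    qed (use y1 f_nonneg in \<open>auto simp: Q_def\<close>)
    also have "\<dots> \<le> 5 powr p * fml_cost P F d p f w x y"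
      using w'G QsumP[of G] by (intro mult_left_mono) (auto simp: cost_w)
    also have "\<dots> \<le> ((4 * 3 powr (p - 1) + 2) * 3 powr p) * fml_cost P F d p f w x y"
    proof (rule mult_right_mono)
      \<comment> \<open>Through \<open>9 powr p\<close>, a product of two factors
        \<open>3 powr p\<close>; one of them is \<open>3 * 3 powr (p - 1)\<close> and thus at most
        the bracket in the claimed bound.\<close>
      have "(5::real) powr p \<le> (3 * 3) powr p" using p by (intro powr_mono2) auto
      also have "\<dots> = 3 powr p * 3 powr p" by (simp only: powr_mult)
      also have "\<dots> \<le> (4 * 3 powr (p - 1) + 2) * 3 powr p"
      proof (rule mult_right_mono)
        have "(3::real) powr p = 3 * 3 powr (p - 1)" by (simp add: powr_diff)
        then show "(3::real) powr p \<le> 4 * 3 powr (p - 1) + 2"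
          using powr_ge_zero[of 3 "p - 1"] by linarith
      qed simp
      finally show "(5::real) powr p \<le> (4 * 3 powr (p - 1) + 2) * 3 powr p" .
      show "0 \<le> fml_cost P F d p f w x y"
        unfolding cost_w using f_nonneg y_nonneg w_nonneg G_nonneg
        by (intro add_nonneg_nonneg sum_nonneg) auto
    qed
    finally show ?thesis .
  qed
  ultimately show ?thesis unfolding w'_def R_def by blast
qed

end
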